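(* Let $\mathbb{F}$ be a field and $n,m,p,s,r\ge1$ integers with $s\le m-1$ and $$\binom{n+p-1}{p}\ \ge\ \frac{m\binom{s+r-1}{r}}{m-s}.$$ Assume $\mathrm{char}(\mathbb{F})=0$ or $p\le \mathrm{char}(\mathbb{F})-1$, and put $k=\binom{n+p-1}{p}$. Then for every homogeneous polynomial mapping $P\in Pol^p_{hom}(\mathbb{F}^n,\mathbb{F}^m)$ outside a subset of codimension at least $1$ of $Pol^p_{hom}(\mathbb{F}^n,\mathbb{F}^m)$, the image $P(\mathbb{F}^n)$ contains a $k$-tuple of points of $\mathbb{F}^m$ that is $(s,r)$-weakly elusive.
   Context: $Pol^p_{hom}(\mathbb{F}^n,\mathbb{F}^m)$ is the vector space of homogeneous polynomial mappings $\mathbb{F}^n\to\mathbb{F}^m$ of degree $p$ (each component homogeneous of degree $p$). A subset (e.g. a tuple of points) $A\subset\mathbb{F}^m$ is $(s,r)$-weakly elusive if $A$ is not contained in the image of any homogeneous polynomial mapping $\Gamma:\mathbb{F}^s\to\mathbb{F}^m$ of degree $r$. *)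

theory Defs
  imports
    Complex_Main
    "HOL-Library.Poly_Mapping"
    "HOL-Library.FuncSet"
    "HOL-Library.Extended_Nat"
    "HOL-Algebra.Ideal"
begin

text \<open>
  A polynomial in variables indexed by \<open>'i\<close> is a finitely supported map from exponent
  vectors \<open>'i \<Rightarrow>\<^sub>0 nat\<close> to coefficients, multiplied by convolution.
\<close>

type_synonym ('i, 'a) mpoly = "('i \<Rightarrow>\<^sub>0 nat) \<Rightarrow>\<^sub>0 'a"

definition mon_degree :: "('i \<Rightarrow>\<^sub>0 nat) \<Rightarrow> nat"
  where "mon_degree e = (\<Sum>i\<in>Poly_Mapping.keys e. Poly_Mapping.lookup e i)"

definition mpolys :: "'i set \<Rightarrow> ('i, 'a::zero) mpoly set"
  where "mpolys I = {f. \<forall>e\<in>Poly_Mapping.keys f. Poly_Mapping.keys e \<subseteq> I}"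

definition mpoly_eval :: "('i, 'a::comm_semiring_1) mpoly \<Rightarrow> ('i \<Rightarrow> 'a) \<Rightarrow> 'a"
  where "mpoly_eval f x =
    (\<Sum>e\<in>Poly_Mapping.keys f.
       Poly_Mapping.lookup f e * (\<Prod>i\<in>Poly_Mapping.keys e. x i ^ Poly_Mapping.lookup e i))"

definition hom_monomials :: "nat \<Rightarrow> nat \<Rightarrow> (nat \<Rightarrow>\<^sub>0 nat) set"
  where "hom_monomials n d = {e. Poly_Mapping.keys e \<subseteq> {..<n} \<and> mon_degree e = d}"

definition hom_polys :: "nat \<Rightarrow> nat \<Rightarrow> (nat, 'a::zero) mpoly set"
  where "hom_polys n d = {f. Poly_Mapping.keys f \<subseteq> hom_monomials n d}"

definition affine_space :: "nat \<Rightarrow> (nat \<Rightarrow> 'a) set"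
  where "affine_space n = {..<n} \<rightarrow>\<^sub>E UNIV"

definition Pol_hom :: "nat \<Rightarrow> nat \<Rightarrow> nat \<Rightarrow> (nat \<Rightarrow> (nat, 'a::zero) mpoly) set"
  where "Pol_hom n m d = {..<m} \<rightarrow>\<^sub>E hom_polys n d"

definition poly_map ::
    "nat \<Rightarrow> (nat \<Rightarrow> (nat, 'a::comm_semiring_1) mpoly) \<Rightarrow> (nat \<Rightarrow> 'a) \<Rightarrow> (nat \<Rightarrow> 'a)"
  where "poly_map m P x = (\<lambda>j\<in>{..<m}. mpoly_eval (P j) x)"

definition poly_image ::
    "nat \<Rightarrow> nat \<Rightarrow> (nat \<Rightarrow> (nat, 'a::comm_semiring_1) mpoly) \<Rightarrow> (nat \<Rightarrow> 'a) set"
  where "poly_image n m P = poly_map m P ` affine_space n"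

definition weakly_elusive :: "nat \<Rightarrow> nat \<Rightarrow> nat \<Rightarrow> (nat \<Rightarrow> 'a::field) set \<Rightarrow> bool"
  where "weakly_elusive m s r A \<longleftrightarrow>
    A \<subseteq> affine_space m \<and> \<not> (\<exists>\<Gamma>\<in>Pol_hom s m r. A \<subseteq> poly_image s m \<Gamma>)"

definition mpoly_ring :: "'i set \<Rightarrow> ('i, 'a::comm_ring_1) mpoly ring"
  where "mpoly_ring I =
    \<lparr>carrier = mpolys I, monoid.mult = (*), one = 1, ring.zero = 0, add = (+)\<rparr>"

lemma cring_mpoly_ring: "cring (mpoly_ring I :: ('i, 'a::comm_ring_1) mpoly ring)"
proof -
  have mult: "f * g \<in> mpolys I" if "f \<in> mpolys I" "g \<in> mpolys I" for f g :: "('i, 'a) mpoly"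
  proof -
    have "Poly_Mapping.keys e \<subseteq> I" if e: "e \<in> Poly_Mapping.keys (f * g)" for e
    proof -
      obtain a b where "a \<in> Poly_Mapping.keys f" "b \<in> Poly_Mapping.keys g" "e = a + b"
        using e keys_mult[of f g] by blast
      then show ?thesis
        using that \<open>f \<in> mpolys I\<close> \<open>g \<in> mpolys I\<close> Poly_Mapping.keys_add[of a b]
        unfolding mpolys_def by blast
    qed
    then show ?thesis by (auto simp: mpolys_def)
  qed
  have add: "f + g \<in> mpolys I" if "f \<in> mpolys I" "g \<in> mpolys I" for f g :: "('i, 'a) mpoly"
    using that Poly_Mapping.keys_add[of f g] unfolding mpolys_def by blast
  have neg: "- f \<in> mpolys I" if "f \<in> mpolys I" for f :: "('i, 'a) mpoly"
    using that by (simp add: mpolys_def)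
  have one: "1 \<in> (mpolys I :: ('i, 'a) mpoly set)" and zero: "0 \<in> (mpolys I :: ('i, 'a) mpoly set)"
    by (auto simp: mpolys_def)
  show ?thesis
    unfolding mpoly_ring_def
    by (intro cringI abelian_groupI comm_monoidI)
       (auto simp: mult add one zero algebra_simps intro!: bexI[OF _ neg])
qed

text \<open>
  The height of a prime \<open>Q\<close> is the supremum of the lengths \<open>d\<close> of chains of primes
  \<open>Q\<^sub>0 \<subset> \<dots> \<subset> Q\<^sub>d = Q\<close>; the chain \<open>C\<close> below is \<open>{Q\<^sub>0, \<dots>, Q\<^bsub>d-1\<^esub>}\<close>.  The height of
  the unit ideal is \<open>\<infinity>\<close>.
\<close>

definition prime_height :: "('b, 'c) ring_scheme \<Rightarrow> 'b set \<Rightarrow> enat"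
  where "prime_height R Q =
    (SUP C \<in> {C. finite C \<and> subset.chain {Q'. primeideal Q' R \<and> Q' \<subset> Q} C}. enat (card C))"

definition ideal_height :: "('b, 'c) ring_scheme \<Rightarrow> 'b set \<Rightarrow> enat"
  where "ideal_height R J = (INF Q \<in> {Q. primeideal Q R \<and> J \<subseteq> Q}. prime_height R Q)"

definition vanishing_ideal :: "'i set \<Rightarrow> ('i \<Rightarrow> 'a::field) set \<Rightarrow> ('i, 'a) mpoly set"
  where "vanishing_ideal I A = {f \<in> mpolys I. \<forall>x\<in>A. mpoly_eval f x = 0}"

text \<open>
  The codimension of a set \<open>A\<close> of points of the affine space with coordinates indexed by \<open>I\<close>
  is the codimension of its Zariski closure, i.e. the height of its vanishing ideal.
  For infinite fields this is \<open>card I\<close> minus the dimension of the Zariski closure.  Over a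
  finite field every set of rational points of a positive-dimensional space has positive
  codimension in this sense, the whole space included.
\<close>

definition codimension :: "'i set \<Rightarrow> ('i \<Rightarrow> 'a::field) set \<Rightarrow> enat"
  where "codimension I A = ideal_height (mpoly_ring I) (vanishing_ideal I A)"

text \<open>
  \<open>Pol_hom n m d\<close> is an affine space whose coordinates are the coefficients of the
  components, indexed by pairs of a component and a monomial.
\<close>

definition coeff_coord :: "(nat \<Rightarrow> (nat, 'a::zero) mpoly) \<Rightarrow> nat \<times> (nat \<Rightarrow>\<^sub>0 nat) \<Rightarrow> 'a"
  where "coeff_coord P = (\<lambda>(j, e). Poly_Mapping.lookup (P j) e)"

definition Pol_codim ::
    "nat \<Rightarrow> nat \<Rightarrow> nat \<Rightarrow> (nat \<Rightarrow> (nat, 'a::field) mpoly) set \<Rightarrow> enat"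
  where "Pol_codim n m d Z = codimension ({..<m} \<times> hom_monomials n d) (coeff_coord ` Z)"

end

theory Submission
  imports
    Defs
    "HOL-Computational_Algebra.Polynomial"
    "HOL-Library.Function_Algebras"
    "HOL-Library.Product_Lexorder"
begin

text \<open>
  As the field has more than \<open>p\<close> elements, there are \<open>k\<close> points \<open>x\<^sub>i\<close> of \<open>F\<^sup>n\<close> whose values determine
  the coefficients of every form of degree \<open>p\<close> linearly.  If the tuple \<open>P(x\<^sub>i)\<close> is not weakly elusive,
  then \<open>P(x\<^sub>i) = \<Gamma>(y\<^sub>i)\<close>, so the \<open>m k\<close> coefficients of \<open>P\<close> are polynomials in the coefficients of \<open>\<Gamma>\<close>
  and the coordinates of the \<open>y\<^sub>i\<close>, and by hypothesis there are at most \<open>m k\<close> of these parameters.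
  By homogeneity of \<open>\<Gamma>\<close> some coordinate of some \<open>y\<^sub>i\<close> can be scaled to 1, unless all \<open>y\<^sub>i\<close> vanish, so
  one parameter is redundant.  Counting monomials now gives a nonzero polynomial in the coefficients
  that vanishes on all bad \<open>P\<close>.  Over a finite field, where such a polynomial may vanish everywhere,
  a cardinality count shows that some \<open>P\<close> is not bad.
\<close>

section \<open>Linear systems and polynomials vanishing on a grid\<close>

text \<open>Gaussian elimination, with unknowns indexed by \<open>A\<close> and equations by
  \<open>B\<close>: an equation whose coefficients all vanish is dropped; any other is solved for an
  unknown \<open>e0\<close>, which removes one equation and one unknown.\<close>

lemma underdetermined_system_solution:
  fixes a :: "'e \<Rightarrow> 'b \<Rightarrow> 'a::field"
  assumes "finite B" "finite A" "card B < card A"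
  shows "\<exists>c. (\<exists>e\<in>A. c e \<noteq> 0) \<and> (\<forall>b\<in>B. (\<Sum>e\<in>A. c e * a e b) = 0)"
  using assms
proof (induction B arbitrary: A a rule: finite_induct)
  case empty
  then have "A \<noteq> {}" by auto
  then show ?case by (intro exI[of _ "\<lambda>_. 1"]) auto
next
  case (insert b0 B)
  show ?case
  proof (cases "\<forall>e\<in>A. a e b0 = 0")
    case True
    obtain c where c: "\<exists>e\<in>A. c e \<noteq> 0" "\<forall>b\<in>B. (\<Sum>e\<in>A. c e * a e b) = 0"
      using insert.IH[of A a] insert.prems insert.hyps by auto
    then show ?thesis using True by (intro exI[of _ c]) auto
  next
    case False
    then obtain e0 where e0: "e0 \<in> A" "a e0 b0 \<noteq> 0" by blast
    define A' where "A' = A - {e0}"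
    have A: "A = insert e0 A'" "e0 \<notin> A'" "finite A'"
      using e0 insert.prems by (auto simp: A'_def)
    have card: "card B < card A'"
      using insert.prems insert.hyps A by simp
    \<comment> \<open>Subtracting \<open>q e\<close> times the coefficients of \<open>e0\<close>
      clears the coefficient of \<open>e\<close> in the equation \<open>b0\<close>.\<close>
    define q where "q e = a e b0 / a e0 b0" for e
    obtain c where c: "\<exists>e\<in>A'. c e \<noteq> 0"
      "\<forall>b\<in>B. (\<Sum>e\<in>A'. c e * (a e b - q e * a e0 b)) = 0"
      using insert.IH[OF A(3) card, of "\<lambda>e b. a e b - q e * a e0 b"] by blast
    \<comment> \<open>The value at \<open>e0\<close> is forced by the equation
      \<open>b0\<close>.\<close>
    define c' where "c' = c(e0 := - (\<Sum>e\<in>A'. c e * q e))"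
    have *: "(\<Sum>e\<in>A. c' e * a e b) = (\<Sum>e\<in>A'. c e * (a e b - q e * a e0 b))" for b
    proof -
      have "(\<Sum>e\<in>A'. c' e * a e b) = (\<Sum>e\<in>A'. c e * a e b)"
        by (rule sum.cong) (use A in \<open>auto simp: c'_def\<close>)
      then show ?thesis using A
        by (simp add: c'_def right_diff_distrib sum_subtractf sum_distrib_right mult.assoc)
    qed
    have "(\<Sum>e\<in>A. c' e * a e b0) = 0"
      unfolding * using e0 by (simp add: q_def)
    moreover have "\<exists>e\<in>A. c' e \<noteq> 0"
      using c(1) A by (auto simp: c'_def)
    ultimately show ?thesis
      using c(2) * by (intro exI[of _ c']) auto
  qed
qed

text \<open>Otherwise \<open>c\<close> would give a nonzero univariate polynomial of degree at most
  \<open>d\<close> with more than \<open>d\<close> roots.\<close>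

lemma sum_power_eq_0_imp_coeffs_0:
  fixes c :: "nat \<Rightarrow> 'a::field"
  assumes "card T > d" "\<And>t. t \<in> T \<Longrightarrow> (\<Sum>j\<le>d. c j * t ^ j) = 0" "j \<le> d"
  shows "c j = 0"
proof (rule ccontr)
  assume "c j \<noteq> 0"
  define q where "q = Abs_poly (\<lambda>i. if i \<le> d then c i else 0)"
  have coeff: "coeff q i = (if i \<le> d then c i else 0)" for i
    unfolding q_def by (subst coeff_Abs_poly[of d]) auto
  have "q \<noteq> 0" using coeff[of j] \<open>c j \<noteq> 0\<close> assms(3) by auto
  have deg: "degree q \<le> d" by (rule degree_le) (simp add: coeff)
  have "poly q t = (\<Sum>j\<le>d. c j * t ^ j)" for t
    unfolding poly_altdef
    by (rule sum.mono_neutral_cong_left) (use deg in \<open>auto simp: coeff intro: le_degree\<close>)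
  then have "T \<subseteq> {t. poly q t = 0}" using assms(2) by auto
  then have "card T \<le> card {t. poly q t = 0}"
    by (rule card_mono[OF poly_roots_finite[OF \<open>q \<noteq> 0\<close>]])
  also have "\<dots> \<le> degree q" by (rule card_poly_roots_bound[OF \<open>q \<noteq> 0\<close>])
  finally show False using deg assms(1) by simp
qed

text \<open>Induction on the variables: with the others fixed in \<open>T\<close>, the sum is a
  polynomial of degree at most \<open>d\<close> in the variable \<open>i0\<close> with more than
  \<open>d\<close> roots. Its coefficients therefore vanish, and the induction hypothesis applies to
  the coefficient that contains \<open>e\<close>.\<close>

lemma polynomial_vanishing_on_grid_coeffs_0:
  fixes c :: "'e \<Rightarrow> 'a::field" and ex :: "'e \<Rightarrow> 'i \<Rightarrow> nat"
  assumes "finite I" "finite S" "card T > d"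
    and "\<And>e i. e \<in> S \<Longrightarrow> i \<in> I \<Longrightarrow> ex e i \<le> d"
    and "\<And>e e'. e \<in> S \<Longrightarrow> e' \<in> S \<Longrightarrow> (\<And>i. i \<in> I \<Longrightarrow> ex e i = ex e' i) \<Longrightarrow> e = e'"
    and "\<And>x. (\<And>i. i \<in> I \<Longrightarrow> x i \<in> T) \<Longrightarrow> (\<Sum>e\<in>S. c e * (\<Prod>i\<in>I. x i ^ ex e i)) = 0"
    and "e \<in> S"
  shows "c e = 0"
  using assms(1,2,4-)
proof (induction I arbitrary: S e rule: finite_induct)
  case empty
  have "S = {e}" using empty by blast
  then show ?case using empty.prems(4)[of "\<lambda>_. undefined"] by simp
next
  case (insert i0 I)
  \<comment> \<open>Monomials with the same exponent of \<open>i0\<close> are still told apart by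
    their exponents in \<open>I\<close>.\<close>
  define S' where "S' = {e'\<in>S. ex e' i0 = ex e i0}"
  show ?case
  proof (rule insert.IH[of S'])
    show "finite S'" "e \<in> S'" using insert.prems by (auto simp: S'_def)
    show "ex e' i \<le> d" if "e' \<in> S'" "i \<in> I" for e' i
      using that insert.prems by (auto simp: S'_def)
    show "e1 = e2" if "e1 \<in> S'" "e2 \<in> S'" "\<And>i. i \<in> I \<Longrightarrow> ex e1 i = ex e2 i" for e1 e2
      by (rule insert.prems(3)) (use that in \<open>auto simp: S'_def\<close>)
    show "(\<Sum>e\<in>S'. c e * (\<Prod>i\<in>I. x i ^ ex e i)) = 0" if x: "\<And>i. i \<in> I \<Longrightarrow> x i \<in> T" for x
    proof -
      \<comment> \<open>\<open>h j\<close> is the coefficient of \<open>t ^ j\<close> once the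
        variables in \<open>I\<close> have the values \<open>x\<close>.\<close>
      define h where "h j = (\<Sum>e\<in>{e\<in>S. ex e i0 = j}. c e * (\<Prod>i\<in>I. x i ^ ex e i))" for j
      have "(\<Sum>j\<le>d. h j * t ^ j) = 0" if t: "t \<in> T" for t
      proof -
        have eq: "(\<Prod>i\<in>insert i0 I. (x(i0 := t)) i ^ ex e i) = t ^ ex e i0 * (\<Prod>i\<in>I. x i ^ ex e i)" for e
        proof -
          have "(\<Prod>i\<in>I. (x(i0 := t)) i ^ ex e i) = (\<Prod>i\<in>I. x i ^ ex e i)"
            by (rule prod.cong) (use insert.hyps in auto)
          then show ?thesis using insert.hyps by simp
        qed
        have "(\<Sum>j\<le>d. h j * t ^ j) =
          (\<Sum>j\<le>d. \<Sum>e\<in>{e\<in>S. ex e i0 = j}. c e * (\<Prod>i\<in>insert i0 I. (x(i0 := t)) i ^ ex e i))"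
          unfolding h_def eq sum_distrib_right by (intro sum.cong refl) (auto simp: mult_ac)
        also have "\<dots> = (\<Sum>e\<in>S. c e * (\<Prod>i\<in>insert i0 I. (x(i0 := t)) i ^ ex e i))"
          by (rule sum.group) (use insert.prems in auto)
        also have "\<dots> = 0"
          by (rule insert.prems(4)) (use x t in auto)
        finally show ?thesis .
      qed
      then have "h (ex e i0) = 0"
        using sum_power_eq_0_imp_coeffs_0[OF assms(3), of h "ex e i0"] insert.prems(2)[of e i0]
          insert.prems(5) by blast
      then show ?thesis by (simp add: h_def S'_def)
    qed
  qed
qed

section \<open>Evaluation over fixed index sets and counting of monomials\<close>

lemma mpoly_eval_eq_sum:
  assumes "finite S" "finite I" "Poly_Mapping.keys f \<subseteq> S" "\<And>e. e \<in> S \<Longrightarrow> Poly_Mapping.keys e \<subseteq> I"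
  shows "mpoly_eval f x =
    (\<Sum>e\<in>S. Poly_Mapping.lookup f e * (\<Prod>i\<in>I. x i ^ Poly_Mapping.lookup e i))"
proof -
  have *: "(\<Prod>i\<in>Poly_Mapping.keys e. x i ^ Poly_Mapping.lookup e i) =
      (\<Prod>i\<in>I. x i ^ Poly_Mapping.lookup e i)" if "e \<in> S" for e
    by (rule prod.mono_neutral_left) (use assms that in \<open>auto simp: in_keys_iff\<close>)
  have "mpoly_eval f x =
    (\<Sum>e\<in>S. Poly_Mapping.lookup f e * (\<Prod>i\<in>Poly_Mapping.keys e. x i ^ Poly_Mapping.lookup e i))"
    unfolding mpoly_eval_def
    by (rule sum.mono_neutral_left) (use assms in \<open>auto simp: in_keys_iff\<close>)
  then show ?thesis using * by simp
qed

lemma obtain_poly_mapping: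
  fixes c :: "'e \<Rightarrow> 'a::zero"
  assumes "finite S"
  obtains f where "\<And>e. Poly_Mapping.lookup f e = (if e \<in> S then c e else 0)" "Poly_Mapping.keys f \<subseteq> S"
proof
  have "finite {e. (if e \<in> S then c e else 0) \<noteq> 0}"
    by (rule finite_subset[OF _ assms]) (auto split: if_splits)
  then show *: "Poly_Mapping.lookup (Abs_poly_mapping (\<lambda>e. if e \<in> S then c e else 0)) e =
      (if e \<in> S then c e else 0)" for e
    by (simp add: Abs_poly_mapping_inverse)
  show "Poly_Mapping.keys (Abs_poly_mapping (\<lambda>e. if e \<in> S then c e else 0)) \<subseteq> S"
    by (auto simp: in_keys_iff * split: if_splits)
qed

lemma bij_betw_box_monomials:
  fixes I :: "'i set" and D :: nat
  assumes "finite I"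
  shows "bij_betw (\<lambda>e. restrict (Poly_Mapping.lookup e) I)
    {e. Poly_Mapping.keys e \<subseteq> I \<and> (\<forall>i\<in>I. Poly_Mapping.lookup e i < D)} (I \<rightarrow>\<^sub>E {..<D})"
proof (rule bij_betwI')
  fix e e' :: "'i \<Rightarrow>\<^sub>0 nat"
  assume e: "e \<in> {e. Poly_Mapping.keys e \<subseteq> I \<and> (\<forall>i\<in>I. Poly_Mapping.lookup e i < D)}"
    and e': "e' \<in> {e. Poly_Mapping.keys e \<subseteq> I \<and> (\<forall>i\<in>I. Poly_Mapping.lookup e i < D)}"
  show "(restrict (Poly_Mapping.lookup e) I = restrict (Poly_Mapping.lookup e') I) = (e = e')"
  proof
    assume eq: "restrict (Poly_Mapping.lookup e) I = restrict (Poly_Mapping.lookup e') I"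
    have "Poly_Mapping.lookup e i = Poly_Mapping.lookup e' i" for i
    proof (cases "i \<in> I")
      case True
      then show ?thesis using fun_cong[OF eq, of i] by simp
    next
      case False
      then show ?thesis using e e' by (metis (mono_tags, lifting) in_keys_iff mem_Collect_eq subsetD)
    qed
    then show "e = e'" by (rule poly_mapping_eqI)
  qed simp
next
  fix e :: "'i \<Rightarrow>\<^sub>0 nat"
  assume "e \<in> {e. Poly_Mapping.keys e \<subseteq> I \<and> (\<forall>i\<in>I. Poly_Mapping.lookup e i < D)}"
  then show "restrict (Poly_Mapping.lookup e) I \<in> I \<rightarrow>\<^sub>E {..<D}" by auto
next
  fix h :: "'i \<Rightarrow> nat"
  assume h: "h \<in> I \<rightarrow>\<^sub>E {..<D}"
  obtain e where e: "\<And>i. Poly_Mapping.lookup e i = (if i \<in> I then h i else 0)" "Poly_Mapping.keys e \<subseteq> I"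
    using obtain_poly_mapping[OF assms, of h] by blast
  have "h = restrict (Poly_Mapping.lookup e) I"
    using h by (auto simp: e fun_eq_iff PiE_def extensional_def)
  moreover have "e \<in> {e. Poly_Mapping.keys e \<subseteq> I \<and> (\<forall>i\<in>I. Poly_Mapping.lookup e i < D)}"
    using h e by auto
  ultimately show "\<exists>e\<in>{e. Poly_Mapping.keys e \<subseteq> I \<and> (\<forall>i\<in>I. Poly_Mapping.lookup e i < D)}.
      h = restrict (Poly_Mapping.lookup e) I"
    by blast
qed

lemma
  fixes I :: "'i set" and D :: nat
  assumes "finite I"
  shows finite_box_monomials:
      "finite {e. Poly_Mapping.keys e \<subseteq> I \<and> (\<forall>i\<in>I. Poly_Mapping.lookup e i < D)}"
    and card_box_monomials:
      "card {e. Poly_Mapping.keys e \<subseteq> I \<and> (\<forall>i\<in>I. Poly_Mapping.lookup e i < D)} = D ^ card I"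
proof -
  show "finite {e. Poly_Mapping.keys e \<subseteq> I \<and> (\<forall>i\<in>I. Poly_Mapping.lookup e i < D)}"
    using bij_betw_finite[OF bij_betw_box_monomials[OF assms, of D]] assms
    by (simp add: finite_PiE)
  show "card {e. Poly_Mapping.keys e \<subseteq> I \<and> (\<forall>i\<in>I. Poly_Mapping.lookup e i < D)} = D ^ card I"
    using bij_betw_same_card[OF bij_betw_box_monomials[OF assms, of D]] assms
    by (simp add: card_PiE)
qed

section \<open>Functions of bounded degree in each variable\<close>

text \<open>These are functions, not formal polynomials: over a finite field the coefficients
  \<open>c\<close> need not be unique, and only their existence matters. Bounding each exponent
  separately leaves \<open>(d + 1) ^ card V\<close> monomials.\<close>

definition box_polyfuns :: "'v set \<Rightarrow> nat \<Rightarrow> (('v \<Rightarrow> 'a::field) \<Rightarrow> 'a) set"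
  where "box_polyfuns V d =
    {g. \<exists>c. \<forall>x. g x = (\<Sum>\<alpha>\<in>V \<rightarrow>\<^sub>E {..d}. c \<alpha> * (\<Prod>v\<in>V. x v ^ \<alpha> v))}"

lemma box_polyfuns_monomial:
  assumes "finite V" "\<And>v. v \<in> V \<Longrightarrow> \<alpha> v \<le> d"
  shows "(\<lambda>x. \<Prod>v\<in>V. x v ^ \<alpha> v) \<in> box_polyfuns V d"
proof -
  have *: "restrict \<alpha> V \<in> V \<rightarrow>\<^sub>E {..d}" using assms by auto
  have "(\<Prod>v\<in>V. x v ^ \<alpha> v) = (\<Sum>\<beta>\<in>V \<rightarrow>\<^sub>E {..d}.
      (if \<beta> = restrict \<alpha> V then 1 else 0) * (\<Prod>v\<in>V. x v ^ \<beta> v))" for x :: "'a \<Rightarrow> 'b"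
  proof -
    have "(\<Sum>\<beta>\<in>V \<rightarrow>\<^sub>E {..d}. (if \<beta> = restrict \<alpha> V then 1 else 0) * (\<Prod>v\<in>V. x v ^ \<beta> v)) =
      (\<Sum>\<beta>\<in>V \<rightarrow>\<^sub>E {..d}. (if \<beta> = restrict \<alpha> V then (\<Prod>v\<in>V. x v ^ \<beta> v) else 0))"
      by (intro sum.cong) auto
    also have "\<dots> = (\<Prod>v\<in>V. x v ^ restrict \<alpha> V v)"
      using * assms(1) by (simp add: finite_PiE)
    also have "\<dots> = (\<Prod>v\<in>V. x v ^ \<alpha> v)" by (rule prod.cong) auto
    finally show ?thesis ..
  qed
  then show ?thesis unfolding box_polyfuns_def
    by (intro CollectI exI[of _ "\<lambda>\<beta>. if \<beta> = restrict \<alpha> V then 1 else 0"]) blast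
qed

lemma box_polyfuns_scale:
  assumes "g \<in> box_polyfuns V d"
  shows "(\<lambda>x. a * g x) \<in> box_polyfuns V d"
proof -
  obtain c where "\<forall>x. g x = (\<Sum>\<alpha>\<in>V \<rightarrow>\<^sub>E {..d}. c \<alpha> * (\<Prod>v\<in>V. x v ^ \<alpha> v))"
    using assms by (auto simp: box_polyfuns_def)
  then have "\<forall>x. a * g x = (\<Sum>\<alpha>\<in>V \<rightarrow>\<^sub>E {..d}. (a * c \<alpha>) * (\<Prod>v\<in>V. x v ^ \<alpha> v))"
    by (simp add: sum_distrib_left mult.assoc)
  then show ?thesis unfolding box_polyfuns_def by (intro CollectI exI)
qed

lemma box_polyfuns_sum:
  assumes "\<And>j. j \<in> J \<Longrightarrow> g j \<in> box_polyfuns V d"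
  shows "(\<lambda>x. \<Sum>j\<in>J. g j x) \<in> box_polyfuns V d"
proof -
  have "\<forall>j\<in>J. \<exists>c. \<forall>x. g j x = (\<Sum>\<alpha>\<in>V \<rightarrow>\<^sub>E {..d}. c \<alpha> * (\<Prod>v\<in>V. x v ^ \<alpha> v))"
    using assms by (auto simp: box_polyfuns_def)
  then obtain c where c: "\<And>j x. j \<in> J \<Longrightarrow>
      g j x = (\<Sum>\<alpha>\<in>V \<rightarrow>\<^sub>E {..d}. c j \<alpha> * (\<Prod>v\<in>V. x v ^ \<alpha> v))"
    by metis
  have "(\<Sum>j\<in>J. g j x) = (\<Sum>\<alpha>\<in>V \<rightarrow>\<^sub>E {..d}. (\<Sum>j\<in>J. c j \<alpha>) * (\<Prod>v\<in>V. x v ^ \<alpha> v))" for x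
    by (simp add: c sum_distrib_right sum.swap[of _ J])
  then show ?thesis unfolding box_polyfuns_def
    by (intro CollectI exI[of _ "\<lambda>\<alpha>. \<Sum>j\<in>J. c j \<alpha>"]) blast
qed

lemma box_polyfuns_mult:
  assumes "finite V" "g \<in> box_polyfuns V d" "g' \<in> box_polyfuns V d'"
  shows "(\<lambda>x. g x * g' x) \<in> box_polyfuns V (d + d')"
proof -
  obtain c where c: "\<And>x. g x = (\<Sum>\<alpha>\<in>V \<rightarrow>\<^sub>E {..d}. c \<alpha> * (\<Prod>v\<in>V. x v ^ \<alpha> v))"
    using assms(2) by (auto simp: box_polyfuns_def)
  obtain c' where c': "\<And>x. g' x = (\<Sum>\<alpha>\<in>V \<rightarrow>\<^sub>E {..d'}. c' \<alpha> * (\<Prod>v\<in>V. x v ^ \<alpha> v))"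
    using assms(3) by (auto simp: box_polyfuns_def)
  have "(\<lambda>x. g x * g' x) = (\<lambda>x. \<Sum>\<alpha>\<in>V \<rightarrow>\<^sub>E {..d}. \<Sum>\<beta>\<in>V \<rightarrow>\<^sub>E {..d'}.
      (c \<alpha> * c' \<beta>) * (\<Prod>v\<in>V. x v ^ (\<alpha> v + \<beta> v)))"
    unfolding c c' sum_product power_add prod.distrib
    by (intro ext sum.cong refl) (simp add: mult_ac)
  also have "\<dots> \<in> box_polyfuns V (d + d')"
    using assms(1)
    by (intro box_polyfuns_sum box_polyfuns_scale box_polyfuns_monomial) (auto intro!: add_mono)
  finally show ?thesis .
qed

lemma box_polyfuns_mono:
  assumes "finite V" "d \<le> d'" "g \<in> box_polyfuns V d"
  shows "g \<in> box_polyfuns V d'"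
proof -
  obtain c where "\<And>x. g x = (\<Sum>\<alpha>\<in>V \<rightarrow>\<^sub>E {..d}. c \<alpha> * (\<Prod>v\<in>V. x v ^ \<alpha> v))"
    using assms(3) by (auto simp: box_polyfuns_def)
  then have "g = (\<lambda>x. \<Sum>\<alpha>\<in>V \<rightarrow>\<^sub>E {..d}. c \<alpha> * (\<Prod>v\<in>V. x v ^ \<alpha> v))" by blast
  also have "\<dots> \<in> box_polyfuns V d'"
    using assms(1,2)
    by (intro box_polyfuns_sum box_polyfuns_scale box_polyfuns_monomial) (auto intro: order_trans)
  finally show ?thesis .
qed

lemma box_polyfuns_one: "finite V \<Longrightarrow> (\<lambda>x. 1) \<in> box_polyfuns V d"
  using box_polyfuns_monomial[of V "\<lambda>_. 0" d] by simp

lemma box_polyfuns_power: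
  assumes "finite V" "g \<in> box_polyfuns V d"
  shows "(\<lambda>x. g x ^ n) \<in> box_polyfuns V (n * d)"
  by (induction n) (use assms box_polyfuns_one box_polyfuns_mult in auto)

lemma box_polyfuns_prod:
  assumes "finite V" "finite I" "\<And>i. i \<in> I \<Longrightarrow> g i \<in> box_polyfuns V d"
  shows "(\<lambda>x. \<Prod>i\<in>I. g i x) \<in> box_polyfuns V (card I * d)"
  using assms(2,3)
  by (induction I rule: finite_induct)
    (auto intro: box_polyfuns_one[OF assms(1)] box_polyfuns_mult[OF assms(1)])

text \<open>Setting \<open>v0\<close> to 1 drops its factor from every monomial, so one parameter
  disappears and the degree bound is kept.\<close>

lemma box_polyfuns_fix_variable:
  assumes "finite V" "v0 \<in> V" "g \<in> box_polyfuns V d"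
  shows "(\<lambda>x. g (x(v0 := 1))) \<in> box_polyfuns (V - {v0}) d"
proof -
  obtain c where c: "\<And>x. g x = (\<Sum>\<alpha>\<in>V \<rightarrow>\<^sub>E {..d}. c \<alpha> * (\<Prod>v\<in>V. x v ^ \<alpha> v))"
    using assms(3) by (auto simp: box_polyfuns_def)
  have "(\<Prod>v\<in>V. (x(v0 := 1)) v ^ \<alpha> v) = (\<Prod>v\<in>V - {v0}. x v ^ \<alpha> v)"
    for x :: "'a \<Rightarrow> 'b" and \<alpha> :: "'a \<Rightarrow> nat"
    using assms(1,2) by (simp add: prod.remove)
  then have "(\<lambda>x. g (x(v0 := 1))) =
      (\<lambda>x. \<Sum>\<alpha>\<in>V \<rightarrow>\<^sub>E {..d}. c \<alpha> * (\<Prod>v\<in>V - {v0}. x v ^ \<alpha> v))"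
    by (simp add: c)
  also have "\<dots> \<in> box_polyfuns (V - {v0}) d"
    using assms(1)
    by (intro box_polyfuns_sum box_polyfuns_scale box_polyfuns_monomial) auto
  finally show ?thesis .
qed

section \<open>Algebraic relations between functions of few variables\<close>

text \<open>
  Too few variables force an algebraic relation: the \<open>D ^ card I\<close> products of powers of the
  \<open>g t i\<close> with exponents below \<open>D\<close> live in a space of dimension \<open>O(D ^ (card I - 1))\<close>.  Solving
  a single linear system for all \<open>t\<close> at once yields one relation common to all families.
\<close>

lemma common_algebraic_relation:
  fixes g :: "'t \<Rightarrow> 'i \<Rightarrow> ('v \<Rightarrow> 'a::field) \<Rightarrow> 'a"
  assumes "finite I" "finite T" "I \<noteq> {}"
    and V: "\<And>t. t \<in> T \<Longrightarrow> finite (V t)" "\<And>t. t \<in> T \<Longrightarrow> card (V t) < card I"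
    and g: "\<And>t i. t \<in> T \<Longrightarrow> i \<in> I \<Longrightarrow> g t i \<in> box_polyfuns (V t) d"
  shows "\<exists>f\<in>mpolys I. f \<noteq> 0 \<and> (\<forall>t\<in>T. \<forall>x. mpoly_eval f (\<lambda>i. g t i x) = 0)"
proof -
  define N where "N = card I"
  have N: "N > 0" using assms by (simp add: N_def card_gt_0_iff)
  \<comment> \<open>\<open>L\<close> and \<open>D\<close> are chosen so that
    \<open>N * (D * d) + 1 \<le> L * D\<close> and \<open>card T * L ^ (N - 1) < D\<close>. Hence
    there are fewer equations than the \<open>D ^ N\<close> unknowns.\<close>
  define L where "L = N * d + 1"
  define D where "D = card T * L ^ (N - 1) + 1"
  define S where "S = {e. Poly_Mapping.keys e \<subseteq> I \<and> (\<forall>i\<in>I. Poly_Mapping.lookup e i < D)}"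
  \<comment> \<open>One equation for each \<open>t\<close> and each monomial in the parameters
    \<open>V t\<close>: its coefficient in the expanded relation has to vanish.\<close>
  define B where "B = Sigma T (\<lambda>t. V t \<rightarrow>\<^sub>E {..N * (D * d)})"
  have S: "finite S" "card S = D ^ N"
    using finite_box_monomials[OF assms(1)] card_box_monomials[OF assms(1)]
    by (auto simp: S_def N_def)
  have finB: "finite B" unfolding B_def using assms(2) V(1) by (auto intro!: finite_SigmaI finite_PiE)
  have "card B = (\<Sum>t\<in>T. (N * (D * d) + 1) ^ card (V t))"
    unfolding B_def using assms(2) V(1) by (subst card_SigmaI) (auto simp: card_PiE finite_PiE)
  also have "\<dots> \<le> (\<Sum>t\<in>T. (N * (D * d) + 1) ^ (N - 1))"
    by (intro sum_mono power_increasing) (use V(2) in \<open>force simp: N_def\<close>)+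
  also have "\<dots> \<le> (\<Sum>t\<in>T. (L * D) ^ (N - 1))"
    by (intro sum_mono power_mono) (auto simp: L_def D_def algebra_simps)
  also have "\<dots> = card T * L ^ (N - 1) * D ^ (N - 1)"
    by (simp add: power_mult_distrib)
  also have "\<dots> < D * D ^ (N - 1)"
    by (simp add: D_def)
  also have "\<dots> = D ^ N" using N by (simp add: power_eq_if)
  finally have card: "card B < card S" by (simp add: S)
  have "(\<lambda>x. \<Prod>i\<in>I. g t i x ^ Poly_Mapping.lookup e i) \<in> box_polyfuns (V t) (N * (D * d))"
    if t: "t \<in> T" and e: "e \<in> S" for t e
    unfolding N_def
  proof (rule box_polyfuns_prod[OF V(1)[OF t] assms(1)])
    fix i assume i: "i \<in> I"
    show "(\<lambda>x. g t i x ^ Poly_Mapping.lookup e i) \<in> box_polyfuns (V t) (D * d)"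
      by (rule box_polyfuns_mono[OF V(1)[OF t] _ box_polyfuns_power[OF V(1)[OF t] g[OF t i]]])
        (use e i in \<open>auto simp: S_def intro: less_imp_le\<close>)
  qed
  then have ex: "\<exists>c. \<forall>x. (\<Prod>i\<in>I. g t i x ^ Poly_Mapping.lookup e i) =
      (\<Sum>\<alpha>\<in>V t \<rightarrow>\<^sub>E {..N * (D * d)}. c \<alpha> * (\<Prod>v\<in>V t. x v ^ \<alpha> v))"
    if "t \<in> T" "e \<in> S" for t e
    using that by (auto simp: box_polyfuns_def)
  define c where "c t e = (SOME c. \<forall>x. (\<Prod>i\<in>I. g t i x ^ Poly_Mapping.lookup e i) =
      (\<Sum>\<alpha>\<in>V t \<rightarrow>\<^sub>E {..N * (D * d)}. c \<alpha> * (\<Prod>v\<in>V t. x v ^ \<alpha> v)))" for t e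
  have c: "(\<Prod>i\<in>I. g t i x ^ Poly_Mapping.lookup e i) =
      (\<Sum>\<alpha>\<in>V t \<rightarrow>\<^sub>E {..N * (D * d)}. c t e \<alpha> * (\<Prod>v\<in>V t. x v ^ \<alpha> v))"
    if "t \<in> T" "e \<in> S" for t e x
    using someI_ex[OF ex[OF that]] unfolding c_def by blast
  obtain w where w: "\<exists>e\<in>S. w e \<noteq> 0" "\<forall>b\<in>B. (\<Sum>e\<in>S. w e * c (fst b) e (snd b)) = 0"
    using underdetermined_system_solution[OF finB S(1) card, of "\<lambda>e b. c (fst b) e (snd b)"]
    by blast
  obtain f where f: "\<And>e. Poly_Mapping.lookup f e = (if e \<in> S then w e else 0)"
    "Poly_Mapping.keys f \<subseteq> S"
    using obtain_poly_mapping[OF S(1), of w] by blast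
  have "f \<in> mpolys I" using f(2) by (auto simp: mpolys_def S_def)
  moreover have "f \<noteq> 0" using w(1) f(1) by (metis lookup_zero)
  moreover have "mpoly_eval f (\<lambda>i. g t i x) = 0" if t: "t \<in> T" for t x
  proof -
    have "mpoly_eval f (\<lambda>i. g t i x) =
        (\<Sum>e\<in>S. w e * (\<Prod>i\<in>I. g t i x ^ Poly_Mapping.lookup e i))"
      by (subst mpoly_eval_eq_sum[OF S(1) assms(1) f(2)]) (auto simp: S_def f(1))
    also have "\<dots> = (\<Sum>e\<in>S. \<Sum>\<alpha>\<in>V t \<rightarrow>\<^sub>E {..N * (D * d)}.
        w e * c t e \<alpha> * (\<Prod>v\<in>V t. x v ^ \<alpha> v))"
      by (simp add: c[OF t] sum_distrib_left mult.assoc)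
    also have "\<dots> = (\<Sum>\<alpha>\<in>V t \<rightarrow>\<^sub>E {..N * (D * d)}.
        (\<Sum>e\<in>S. w e * c t e \<alpha>) * (\<Prod>v\<in>V t. x v ^ \<alpha> v))"
      by (simp add: sum.swap[of _ S] sum_distrib_right)
    also have "\<dots> = 0"
      using w(2) t by (intro sum.neutral) (force simp: B_def)
    finally show ?thesis .
  qed
  ultimately show ?thesis by blast
qed

section \<open>Positive codimension from a nonzero polynomial\<close>

text \<open>The linear order on the variables induces an order on the monomials compatible with
  multiplication, so leading terms cannot cancel. The coefficient coordinates are pairs, ordered
  lexicographically.\<close>

lemma domain_mpoly_ring: "domain (mpoly_ring I :: ('i::linorder, 'a::field) mpoly ring)"
  unfolding domain_def domain_axioms_def
  using cring_mpoly_ring[of I] by (auto simp: mpoly_ring_def)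

text \<open>Every prime containing the vanishing ideal contains \<open>f\<close>, hence lies
  strictly above the zero ideal, which is prime in a domain.\<close>

lemma one_le_codimension:
  fixes f :: "('i::linorder, 'a::field) mpoly"
  assumes "f \<in> vanishing_ideal I A" "f \<noteq> 0"
  shows "codimension I A \<ge> 1"
  unfolding codimension_def ideal_height_def
proof (rule INF_greatest)
  let ?R = "mpoly_ring I :: ('i, 'a) mpoly ring"
  fix Q assume "Q \<in> {Q. primeideal Q ?R \<and> vanishing_ideal I A \<subseteq> Q}"
  then have Q: "primeideal Q ?R" "f \<in> Q" using assms by auto
  interpret primeideal Q ?R by (rule Q)
  have "0 \<in> Q"
    using additive_subgroup.zero_closed[OF is_additive_subgroup] by (simp add: mpoly_ring_def)
  then have "{0} \<subset> Q" using Q(2) assms(2) by auto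
  moreover have "primeideal {0} ?R"
    using domain.zeroprimeideal[OF domain_mpoly_ring, of I] by (simp add: mpoly_ring_def)
  \<comment> \<open>A chain lists only the primes strictly below \<open>Q\<close>, so one member
    already gives height at least 1.\<close>
  ultimately have "{{0}} \<in> {C. finite C \<and> subset.chain {Q'. primeideal Q' ?R \<and> Q' \<subset> Q} C}"
    by (auto simp: subset.chain_def)
  then have "enat (card {{0 :: ('i, 'a) mpoly}}) \<le> prime_height ?R Q"
    unfolding prime_height_def by (rule SUP_upper)
  then show "1 \<le> prime_height ?R Q" by (simp add: one_enat_def)
qed

section \<open>Homogeneous monomials\<close>

lemma mon_degree_eq_sum:
  assumes "Poly_Mapping.keys e \<subseteq> I" "finite I"
  shows "mon_degree e = (\<Sum>i\<in>I. Poly_Mapping.lookup e i)"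
  unfolding mon_degree_def
  by (rule sum.mono_neutral_left) (use assms in \<open>auto simp: in_keys_iff\<close>)

text \<open>Exponent vectors become lists, to which the stars-and-bars count of lists with given
  length and sum applies.\<close>

lemma bij_betw_hom_monomials:
  "bij_betw (\<lambda>e. map (Poly_Mapping.lookup e) [0..<n]) (hom_monomials n d)
     {l. length l = n \<and> sum_list l = d}"
proof (rule bij_betwI')
  fix e e' assume e: "e \<in> hom_monomials n d" "e' \<in> hom_monomials n d"
  show "(map (Poly_Mapping.lookup e) [0..<n] = map (Poly_Mapping.lookup e') [0..<n]) = (e = e')"
  proof
    assume "map (Poly_Mapping.lookup e) [0..<n] = map (Poly_Mapping.lookup e') [0..<n]"
    then have eq: "\<forall>i<n. Poly_Mapping.lookup e i = Poly_Mapping.lookup e' i" by simp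
    have "Poly_Mapping.lookup e i = Poly_Mapping.lookup e' i" for i
    proof (cases "i < n")
      case False
      then have "i \<notin> Poly_Mapping.keys e" "i \<notin> Poly_Mapping.keys e'"
        using e by (auto simp: hom_monomials_def)
      then show ?thesis by (simp add: in_keys_iff)
    qed (use eq in simp)
    then show "e = e'" by (rule poly_mapping_eqI)
  qed simp
next
  fix e assume "e \<in> hom_monomials n d"
  then show "map (Poly_Mapping.lookup e) [0..<n] \<in> {l. length l = n \<and> sum_list l = d}"
    using mon_degree_eq_sum[of e "{..<n}"]
    by (simp add: hom_monomials_def sum_set_upt_conv_sum_list_nat[symmetric] atLeast0LessThan)
next
  fix l :: "nat list" assume l: "l \<in> {l. length l = n \<and> sum_list l = d}"
  obtain e where e: "\<And>i. Poly_Mapping.lookup e i = (if i \<in> {..<n} then l ! i else 0)"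
    "Poly_Mapping.keys e \<subseteq> {..<n}"
    using obtain_poly_mapping[of "{..<n}" "(!) l"] by auto
  have "mon_degree e = d"
    using l e(1) mon_degree_eq_sum[OF e(2)] by (auto simp: sum_list_sum_nth atLeast0LessThan)
  then have "e \<in> hom_monomials n d" using e(2) by (simp add: hom_monomials_def)
  moreover have "l = map (Poly_Mapping.lookup e) [0..<n]"
    using l e(1) by (auto intro: nth_equalityI)
  ultimately show "\<exists>e\<in>hom_monomials n d. l = map (Poly_Mapping.lookup e) [0..<n]" by blast
qed

lemma card_hom_monomials: "card (hom_monomials n d) = (n + d - 1) choose d"
  using bij_betw_same_card[OF bij_betw_hom_monomials[of n d]]
  by (simp add: card_length_sum_list add.commute)

lemma lookup_le_degree:
  assumes "e \<in> hom_monomials n d"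
  shows "Poly_Mapping.lookup e i \<le> d"
proof (cases "i \<in> Poly_Mapping.keys e")
  case True
  then have "Poly_Mapping.lookup e i \<le> mon_degree e"
    unfolding mon_degree_def by (intro member_le_sum) auto
  then show ?thesis using assms by (simp add: hom_monomials_def)
qed (simp add: in_keys_iff)

lemma finite_hom_monomials: "finite (hom_monomials n d)"
  by (rule finite_subset[OF _ finite_box_monomials[of "{..<n}" "Suc d"]])
    (auto simp: less_Suc_eq_le lookup_le_degree, auto simp: hom_monomials_def)

lemma sum_lookup_hom_monomials:
  "e \<in> hom_monomials n d \<Longrightarrow> (\<Sum>i<n. Poly_Mapping.lookup e i) = d"
  using mon_degree_eq_sum[of e "{..<n}"] by (simp add: hom_monomials_def)

lemma mpoly_eval_hom_poly:
  assumes "f \<in> hom_polys n d"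
  shows "mpoly_eval f x =
    (\<Sum>e\<in>hom_monomials n d. Poly_Mapping.lookup f e * (\<Prod>i<n. x i ^ Poly_Mapping.lookup e i))"
  by (rule mpoly_eval_eq_sum)
    (use assms finite_hom_monomials in \<open>auto simp: hom_polys_def hom_monomials_def\<close>)

section \<open>Interpolation of forms\<close>

lemma sum_fun_apply:
  fixes f :: "'b \<Rightarrow> 'c \<Rightarrow> 'd::comm_monoid_add"
  shows "(\<Sum>a\<in>A. f a) x = (\<Sum>a\<in>A. f a x)"
  by (induction A rule: infinite_finite_induct) auto

text \<open>By separation the vectors \<open>v x\<close> span the whole coordinate space of
  \<open>E\<close>, so \<open>card E\<close> of them form a basis. The numbers \<open>b e i\<close>
  are the coordinates of the unit vector at \<open>e\<close> in this basis.\<close>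

lemma exists_dual_points:
  fixes v :: "'x \<Rightarrow> 'e \<Rightarrow> 'a::field"
  assumes "finite E" "X \<noteq> {}"
    and separating: "\<And>c. (\<And>x. x \<in> X \<Longrightarrow> (\<Sum>e\<in>E. c e * v x e) = 0) \<Longrightarrow> \<forall>e\<in>E. c e = 0"
  shows "\<exists>x b. (\<forall>i. x i \<in> X) \<and>
    (\<forall>e\<in>E. \<forall>e'\<in>E. (\<Sum>i<card E. b e i * v (x i) e') = (if e = e' then 1 else 0))"
proof -
  interpret vs: vector_space "\<lambda>(c::'a) (f::'e \<Rightarrow> 'a) e. c * f e"
    by standard (auto simp: fun_eq_iff algebra_simps)
  \<comment> \<open>Cutting off outside \<open>E\<close> puts the vectors into the span of the
    finitely many unit vectors.\<close>
  define u where "u x = (\<lambda>e. if e \<in> E then v x e else 0)" for x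
  define unit where "unit e = (\<lambda>e'. if e = e' then 1 else 0 :: 'a)" for e :: 'e
  have span_unit: "f \<in> vs.span (unit ` E)" if "\<And>e. e \<notin> E \<Longrightarrow> f e = 0" for f
  proof -
    have "f = (\<Sum>e\<in>E. (\<lambda>e'. f e * unit e e'))"
      using that assms(1) by (auto simp: fun_eq_iff unit_def sum_fun_apply if_distrib cong: if_cong)
    also have "\<dots> \<in> vs.span (unit ` E)"
      by (intro vs.span_sum vs.span_scale vs.span_base) auto
    finally show ?thesis .
  qed
  obtain B where B: "B \<subseteq> u ` X" "vs.independent B" "u ` X \<subseteq> vs.span B"
    using vs.maximal_independent_subset by blast
  have unitE: "finite (unit ` E)" "card (unit ` E) \<le> card E"
    using assms(1) by (auto intro: card_image_le)
  have "B \<subseteq> vs.span (unit ` E)" using B(1) by (auto intro!: span_unit simp: u_def)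
  then have finB: "finite B" and "card B \<le> card E"
    using vs.independent_span_bound[OF unitE(1) B(2)] unitE(2) by auto
  \<comment> \<open>A nonzero \<open>c\<close> orthogonal to too small a basis would be orthogonal
    to every \<open>v x\<close>.\<close>
  have "\<not> card B < card E"
  proof
    assume "card B < card E"
    then obtain c where c: "\<exists>e\<in>E. c e \<noteq> 0" "\<forall>b\<in>B. (\<Sum>e\<in>E. c e * b e) = 0"
      using underdetermined_system_solution[OF finB assms(1), of "\<lambda>e b. b e"] by blast
    have "(\<Sum>e\<in>E. c e * v x e) = 0" if "x \<in> X" for x
    proof -
      have "u x \<in> vs.span B" using B(3) that by blast
      then obtain w where w: "u x = (\<Sum>b\<in>B. (\<lambda>e. w b * b e))"
        unfolding vs.span_finite[OF finB] by blast
      have "(\<Sum>e\<in>E. c e * v x e) = (\<Sum>e\<in>E. c e * u x e)" by (simp add: u_def)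
      also have "\<dots> = (\<Sum>b\<in>B. w b * (\<Sum>e\<in>E. c e * b e))"
        by (simp add: w sum_fun_apply sum_distrib_left sum.swap[of _ E] mult_ac)
      also have "\<dots> = 0" using c(2) by simp
      finally show ?thesis .
    qed
    then show False using separating c(1) by blast
  qed
  with \<open>card B \<le> card E\<close> have cardB: "card B = card E" by simp
  \<comment> \<open>A unit vector outside the span would enlarge \<open>B\<close> to
    \<open>card E + 1\<close> independent vectors.\<close>
  have unit_span: "unit e \<in> vs.span B" if "e \<in> E" for e
  proof (rule ccontr)
    assume *: "unit e \<notin> vs.span B"
    then have "unit e \<notin> B" using vs.span_base by blast
    moreover have "insert (unit e) B \<subseteq> vs.span (unit ` E)"
      using \<open>B \<subseteq> vs.span (unit ` E)\<close> that vs.span_base by blast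
    ultimately show False
      using vs.independent_span_bound[OF unitE(1) vs.independent_insertI[OF * B(2)]] unitE(2)
        finB cardB by simp
  qed
  obtain h where h: "bij_betw h {..<card E} B"
    using ex_bij_betw_nat_finite[OF finB] cardB by (auto simp: atLeast0LessThan)
  obtain x0 where "x0 \<in> X" using assms(2) by blast
  \<comment> \<open>The default \<open>x0\<close> only serves to keep \<open>x i\<close> in
    \<open>X\<close> for all indices.\<close>
  define x where "x i = (if i < card E then (SOME x. x \<in> X \<and> u x = h i) else x0)" for i
  have x: "x i \<in> X \<and> u (x i) = h i" if "i < card E" for i
  proof -
    have "h i \<in> u ` X" using B(1) bij_betwE[OF h] that by auto
    then have "\<exists>x. x \<in> X \<and> u x = h i" by auto
    then show ?thesis using someI_ex[of "\<lambda>x. x \<in> X \<and> u x = h i"] that by (simp add: x_def)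
  qed
  have "\<forall>e\<in>E. \<exists>w. unit e = (\<Sum>b\<in>B. (\<lambda>e. w b * b e))"
    using unit_span unfolding vs.span_finite[OF finB] by blast
  then obtain w where w: "\<And>e. e \<in> E \<Longrightarrow> unit e = (\<Sum>b\<in>B. (\<lambda>e'. w e b * b e'))"
    by metis
  have "(\<Sum>i<card E. w e (h i) * v (x i) e') = (if e = e' then 1 else 0)"
    if "e \<in> E" "e' \<in> E" for e e'
  proof -
    have "(\<Sum>i<card E. w e (h i) * v (x i) e') = (\<Sum>i<card E. w e (h i) * h i e')"
    proof (rule sum.cong[OF refl])
      fix i assume "i \<in> {..<card E}"
      then have "u (x i) e' = h i e'" using x by simp
      then show "w e (h i) * v (x i) e' = w e (h i) * h i e'" using that by (simp add: u_def)
    qed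
    also have "\<dots> = (\<Sum>b\<in>B. w e b * b e')"
      by (rule sum.reindex_bij_betw[OF h])
    also have "\<dots> = unit e e'" using w[OF that(1)] by (simp add: sum_fun_apply)
    finally show ?thesis by (simp add: unit_def)
  qed
  moreover have "x i \<in> X" for i using x \<open>x0 \<in> X\<close> by (cases "i < card E") (auto simp: x_def)
  ultimately show ?thesis by (intro exI[of _ x] exI[of _ "\<lambda>e i. w e (h i)"]) blast
qed

text \<open>A form of degree \<open>d\<close> vanishing on the whole space is zero, since the field
  has more than \<open>d\<close> elements. So evaluations separate forms, and dual points recover
  the coefficients linearly from the values.\<close>

lemma exists_interpolation_points:
  assumes "\<exists>T :: 'a::field set. card T > d"
  shows "\<exists>x b. (\<forall>i. x i \<in> affine_space n) \<and>
    (\<forall>e\<in>hom_monomials n d. \<forall>f\<in>hom_polys n d.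
      Poly_Mapping.lookup f e = (\<Sum>i<card (hom_monomials n d). b e i * mpoly_eval f (x i :: nat \<Rightarrow> 'a)))"
proof -
  let ?E = "hom_monomials n d"
  define v where "v x e = (\<Prod>i<n. x i ^ Poly_Mapping.lookup e i)" for x :: "nat \<Rightarrow> 'a" and e
  obtain T :: "'a set" where T: "card T > d" using assms by blast
  have "\<exists>x b. (\<forall>i. x i \<in> (affine_space n :: (nat \<Rightarrow> 'a) set)) \<and>
    (\<forall>e\<in>?E. \<forall>e'\<in>?E. (\<Sum>i<card ?E. b e i * v (x i) e') = (if e = e' then 1 else 0))"
  proof (rule exists_dual_points[OF finite_hom_monomials])
    show "affine_space n \<noteq> ({} :: (nat \<Rightarrow> 'a) set)" by (simp add: affine_space_def PiE_eq_empty_iff)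
    fix c assume c: "\<And>x. x \<in> affine_space n \<Longrightarrow> (\<Sum>e\<in>?E. c e * v x e) = 0"
    show "\<forall>e\<in>?E. c e = 0"
    proof
      fix e assume e: "e \<in> ?E"
      show "c e = 0"
      proof (rule polynomial_vanishing_on_grid_coeffs_0[OF _ finite_hom_monomials T _ _ _ e,
            where I = "{..<n}" and ex = Poly_Mapping.lookup])
        show "Poly_Mapping.lookup e i \<le> d" if "e \<in> ?E" for e i
          by (rule lookup_le_degree[OF that])
        show "e = e'" if "e \<in> ?E" "e' \<in> ?E"
          "\<And>i. i \<in> {..<n} \<Longrightarrow> Poly_Mapping.lookup e i = Poly_Mapping.lookup e' i" for e e'
        proof -
          have "map (Poly_Mapping.lookup e) [0..<n] = map (Poly_Mapping.lookup e') [0..<n]"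
            using that(3) by simp
          then show ?thesis
            using bij_betw_hom_monomials[of n d] that(1,2) by (auto simp: bij_betw_def dest: inj_onD)
        qed
        show "(\<Sum>e\<in>?E. c e * (\<Prod>i\<in>{..<n}. x i ^ Poly_Mapping.lookup e i)) = 0" for x
          using c[of "restrict x {..<n}"] by (simp add: v_def affine_space_def)
      qed simp
    qed
  qed
  then obtain x b where x: "\<forall>i. x i \<in> (affine_space n :: (nat \<Rightarrow> 'a) set)"
    and b: "\<And>e e'. e \<in> ?E \<Longrightarrow> e' \<in> ?E \<Longrightarrow>
      (\<Sum>i<card ?E. b e i * v (x i) e') = (if e = e' then 1 else 0)"
    by blast
  have "Poly_Mapping.lookup f e = (\<Sum>i<card ?E. b e i * mpoly_eval f (x i))"
    if e: "e \<in> ?E" and f: "f \<in> hom_polys n d" for e f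
  proof -
    have "(\<Sum>i<card ?E. b e i * mpoly_eval f (x i)) =
        (\<Sum>i<card ?E. \<Sum>e'\<in>?E. Poly_Mapping.lookup f e' * (b e i * v (x i) e'))"
      by (simp add: mpoly_eval_hom_poly[OF f] v_def sum_distrib_left mult_ac)
    also have "\<dots> = (\<Sum>e'\<in>?E. Poly_Mapping.lookup f e' * (\<Sum>i<card ?E. b e i * v (x i) e'))"
      by (subst sum.swap) (simp add: sum_distrib_left)
    also have "\<dots> = (\<Sum>e'\<in>?E. if e' = e then Poly_Mapping.lookup f e' else 0)"
      by (rule sum.cong) (use b[OF e] in auto)
    also have "\<dots> = Poly_Mapping.lookup f e" using e finite_hom_monomials by simp
    finally show ?thesis ..
  qed
  with x show ?thesis by blast
qed

text \<open>The images of 0, ..., \<open>d\<close> are distinct: a difference of two of these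
  numbers is nonzero and at most \<open>d\<close>, so not a multiple of the characteristic.\<close>

lemma exists_set_card_gt:
  assumes "CHAR('a::field) = 0 \<or> d \<le> CHAR('a) - 1"
  shows "\<exists>T :: 'a set. card T > d"
proof -
  have "inj_on (of_nat :: nat \<Rightarrow> 'a) {..d}"
  proof (rule linorder_inj_onI)
    fix i j :: nat assume ij: "i < j" "j \<in> {..d}"
    show "of_nat i \<noteq> (of_nat j :: 'a)"
    proof
      assume "of_nat i = (of_nat j :: 'a)"
      then have "of_nat (j - i) = (0 :: 'a)" using ij by (simp add: of_nat_diff)
      then have "CHAR('a) dvd j - i" by (simp add: of_nat_eq_0_iff_char_dvd)
      then have "CHAR('a) \<noteq> 0" "CHAR('a) \<le> j - i" using ij by (auto dest: dvd_imp_le intro!: Nat.gr0I)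
      then show False using ij assms by auto
    qed
  qed auto
  then have "card (of_nat ` {..d} :: 'a set) = Suc d" by (simp add: card_image)
  then show ?thesis by (metis lessI)
qed

section \<open>Parametrisation of the exceptional maps\<close>

text \<open>
  A point \<open>w\<close> packs the coefficients \<open>Inl (j, h)\<close> of a homogeneous map \<open>\<Gamma>\<close> and the coordinates
  \<open>Inr (i, l)\<close> of arguments \<open>y\<^sub>i\<close>.  If \<open>b\<close> recovers coefficients from values at interpolation points
  \<open>x\<^sub>i\<close> and \<open>P(x\<^sub>i) = \<Gamma>(y\<^sub>i)\<close> for all \<open>i\<close>, then \<open>bad_coeff k s r b (j, e) w\<close> is the coefficient of
  \<open>P\<^sub>j\<close> at \<open>e\<close>.
\<close>

definition bad_coeff :: "nat \<Rightarrow> nat \<Rightarrow> nat \<Rightarrow> ('e \<Rightarrow> nat \<Rightarrow> 'a::field) \<Rightarrow> nat \<times> 'e \<Rightarrow>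
    (nat \<times> (nat \<Rightarrow>\<^sub>0 nat) + nat \<times> nat \<Rightarrow> 'a) \<Rightarrow> 'a"
  where "bad_coeff k s r b q w = (\<Sum>i<k. b (snd q) i * (\<Sum>h\<in>hom_monomials s r.
    w (Inl (fst q, h)) * (\<Prod>l<s. w (Inr (i, l)) ^ Poly_Mapping.lookup h l)))"

definition bad_params :: "nat \<Rightarrow> nat \<Rightarrow> nat \<Rightarrow> nat \<Rightarrow> (nat \<times> (nat \<Rightarrow>\<^sub>0 nat) + nat \<times> nat) set"
  where "bad_params k m s r = ({..<m} \<times> hom_monomials s r) <+> ({..<k} \<times> {..<s})"

lemma finite_bad_params: "finite (bad_params k m s r)"
  unfolding bad_params_def by (intro finite_Plus finite_cartesian_product finite_hom_monomials) auto

text \<open>Cleared of its denominator, the binomial hypothesis of the theorem says that this number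
  is at most \<open>m * k\<close>, the number of coefficients of \<open>P\<close>.\<close>

lemma card_bad_params: "card (bad_params k m s r) = m * ((s + r - 1) choose r) + k * s"
  unfolding bad_params_def by (subst card_Plus) (auto simp: finite_hom_monomials card_hom_monomials)

text \<open>Each summand is a constant times one coefficient of \<Gamma> times a monomial of degree
  \<open>r\<close> in the coordinates of one \<open>y\<^sub>i\<close>. As \<open>r \<ge> 1\<close>,
  the bound \<open>r\<close> also covers the exponent 1 of the coefficient.\<close>

lemma bad_coeff_in_box_polyfuns:
  fixes b :: "'e \<Rightarrow> nat \<Rightarrow> 'a::field"
  assumes "fst q < m" "r \<ge> 1"
  shows "bad_coeff k s r b q \<in> box_polyfuns (bad_params k m s r) r"
proof -
  have "(\<lambda>w :: _ \<Rightarrow> 'a. w (Inl (fst q, h)) * (\<Prod>l<s. w (Inr (i, l)) ^ Poly_Mapping.lookup h l))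
      \<in> box_polyfuns (bad_params k m s r) r" (is "?g \<in> _")
    if i: "i < k" and h: "h \<in> hom_monomials s r" for i h
  proof -
    \<comment> \<open>The exponent vector of this monomial over all parameters.\<close>
    define \<alpha> :: "nat \<times> (nat \<Rightarrow>\<^sub>0 nat) + nat \<times> nat \<Rightarrow> nat" where
      "\<alpha> v = (case v of Inl q' \<Rightarrow> (if q' = (fst q, h) then 1 else 0)
        | Inr (i', l) \<Rightarrow> (if i' = i then Poly_Mapping.lookup h l else 0))" for v
    have "?g w = (\<Prod>v\<in>bad_params k m s r. w v ^ \<alpha> v)" for w
    proof -
      have "(\<Prod>q'\<in>{..<m} \<times> hom_monomials s r. w (Inl q') ^ \<alpha> (Inl q')) =
          (\<Prod>q'\<in>{..<m} \<times> hom_monomials s r. if q' = (fst q, h) then w (Inl q') else 1)"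
        by (intro prod.cong refl) (auto simp: \<alpha>_def)
      also have "\<dots> = w (Inl (fst q, h))"
        using assms(1) h by (subst prod.delta) (auto simp: finite_hom_monomials)
      finally have 1: "(\<Prod>q'\<in>{..<m} \<times> hom_monomials s r. w (Inl q') ^ \<alpha> (Inl q')) =
        w (Inl (fst q, h))" .
      have "(\<Prod>u\<in>{..<k} \<times> {..<s}. w (Inr u) ^ \<alpha> (Inr u)) =
          (\<Prod>i'<k. \<Prod>l<s. w (Inr (i', l)) ^ \<alpha> (Inr (i', l)))"
        by (simp add: prod.cartesian_product case_prod_unfold)
      also have "\<dots> = (\<Prod>i'<k. if i' = i
          then \<Prod>l<s. w (Inr (i', l)) ^ Poly_Mapping.lookup h l else 1)"
        by (intro prod.cong refl) (auto simp: \<alpha>_def)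
      also have "\<dots> = (\<Prod>l<s. w (Inr (i, l)) ^ Poly_Mapping.lookup h l)"
        using i by (subst prod.delta) auto
      finally show ?thesis using 1 unfolding bad_params_def
        by (subst prod.Plus) (auto simp: finite_hom_monomials)
    qed
    then have "?g = (\<lambda>w. \<Prod>v\<in>bad_params k m s r. w v ^ \<alpha> v)" by blast
    also have "\<dots> \<in> box_polyfuns (bad_params k m s r) r"
      by (rule box_polyfuns_monomial[OF finite_bad_params])
        (use assms(2) lookup_le_degree[OF h] in \<open>auto simp: \<alpha>_def split: sum.splits\<close>)
    finally show ?thesis .
  qed
  then have "(\<lambda>w. bad_coeff k s r b q w) \<in> box_polyfuns (bad_params k m s r) r"
    unfolding bad_coeff_def
    by (intro box_polyfuns_sum box_polyfuns_scale) auto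
  then show ?thesis by simp
qed

lemma bad_coeff_cong:
  assumes "\<And>v. v \<in> bad_params k m s r \<Longrightarrow> w v = w' v" "fst q < m"
  shows "bad_coeff k s r b q w = bad_coeff k s r b q w'"
proof -
  have "w (Inl (fst q, h)) = w' (Inl (fst q, h))" if "h \<in> hom_monomials s r" for h
    using that assms by (auto simp: bad_params_def)
  moreover have "w (Inr (i, l)) = w' (Inr (i, l))" if "i < k" "l < s" for i l
    using that by (intro assms(1)) (auto simp: bad_params_def)
  ultimately show ?thesis unfolding bad_coeff_def by simp
qed

text \<open>As \<open>r\<close> is positive, every monomial of degree \<open>r\<close> involves some
  variable, so \<Gamma> vanishes at the origin.\<close>

lemma bad_coeff_eq_0:
  assumes "\<And>i l. i < k \<Longrightarrow> l < s \<Longrightarrow> w (Inr (i, l)) = 0" "r \<ge> 1"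
  shows "bad_coeff k s r b q w = 0"
proof -
  have "(\<Prod>l<s. w (Inr (i, l)) ^ Poly_Mapping.lookup h l) = 0"
    if "i < k" "h \<in> hom_monomials s r" for i h
  proof -
    have "(\<Sum>l<s. Poly_Mapping.lookup h l) \<noteq> 0"
      using sum_lookup_hom_monomials[OF that(2)] assms(2) by simp
    then obtain l where "l < s" "Poly_Mapping.lookup h l \<noteq> 0" by (meson lessThan_iff sum.neutral)
    then show ?thesis using assms(1) that by (intro prod_zero) (auto intro!: bexI[of _ l])
  qed
  then have "(\<Sum>h\<in>hom_monomials s r. w (Inl (fst q, h)) *
      (\<Prod>l<s. w (Inr (i, l)) ^ Poly_Mapping.lookup h l)) = 0" if "i < k" for i
    using that by (intro sum.neutral) (metis mult_zero_right)
  then show ?thesis unfolding bad_coeff_def by simp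
qed

text \<open>Homogeneity: \<open>(z ^ r \<Gamma>)(y / z) = \<Gamma>(y)\<close>.\<close>

lemma bad_coeff_scale:
  assumes "z \<noteq> 0"
  shows "bad_coeff k s r b q (case_sum (\<lambda>u. z ^ r * w (Inl u)) (\<lambda>u. w (Inr u) / z)) =
    bad_coeff k s r b q w"
proof -
  have "z ^ r * w (Inl (fst q, h)) * (\<Prod>l<s. (w (Inr (i, l)) / z) ^ Poly_Mapping.lookup h l) =
      w (Inl (fst q, h)) * (\<Prod>l<s. w (Inr (i, l)) ^ Poly_Mapping.lookup h l)"
    if "h \<in> hom_monomials s r" for i h
  proof -
    have "(\<Prod>l<s. z ^ Poly_Mapping.lookup h l) = z ^ r"
      using sum_lookup_hom_monomials[OF that] by (simp add: power_sum[symmetric])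
    then show ?thesis using assms by (simp add: power_divide prod_dividef)
  qed
  then show ?thesis unfolding bad_coeff_def by (auto intro!: sum.cong)
qed

section \<open>Relations between the coefficients and an unattained coefficient vector\<close>

text \<open>There may be as many parameters as coefficients, so one has to be saved. Which
  coordinate can be scaled to 1 depends on \<open>w\<close>; hence \<open>f\<close> is taken as a
  common relation for the parametrisations with coordinate \<open>t\<close> set to 1, for all
  \<open>t\<close>.\<close>

lemma bad_coeff_relation_infinite:
  fixes b :: "'e \<Rightarrow> nat \<Rightarrow> 'a::field"
  assumes I: "finite I" "I \<noteq> {}" "\<And>q. q \<in> I \<Longrightarrow> fst q < m"
    and card: "card (bad_params k m s r) \<le> card I" and pos: "r \<ge> 1" "k \<ge> 1" "s \<ge> 1"
  shows "\<exists>f\<in>mpolys I. f \<noteq> 0 \<and> (\<forall>w. mpoly_eval f (\<lambda>q. bad_coeff k s r b q w) = 0)"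
proof -
  let ?V = "bad_params k m s r"
  let ?T = "{..<k} \<times> {..<s}"
  have V: "Inr t \<in> ?V" if "t \<in> ?T" for t using that by (auto simp: bad_params_def)
  have "\<exists>f\<in>mpolys I. f \<noteq> 0 \<and>
      (\<forall>t\<in>?T. \<forall>w. mpoly_eval f (\<lambda>q. bad_coeff k s r b q (w(Inr t := 1))) = 0)"
  proof (rule common_algebraic_relation[OF I(1) _ I(2), where V = "\<lambda>t. ?V - {Inr t}" and d = r])
    show "card (?V - {Inr t}) < card I" if "t \<in> ?T" for t
      using card_Diff1_less[OF finite_bad_params V[OF that]] card by simp
    show "(\<lambda>w. bad_coeff k s r b q (w(Inr t := 1))) \<in> box_polyfuns (?V - {Inr t}) r"
      if "t \<in> ?T" "q \<in> I" for t q
      by (rule box_polyfuns_fix_variable[OF finite_bad_params V[OF that(1)]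
            bad_coeff_in_box_polyfuns[OF I(3)[OF that(2)] pos(1)]])
  qed (auto simp: finite_bad_params)
  then obtain f where f: "f \<in> mpolys I" "f \<noteq> 0"
    "\<And>t w. t \<in> ?T \<Longrightarrow> mpoly_eval f (\<lambda>q. bad_coeff k s r b q (w(Inr t := 1))) = 0"
    by blast
  have "mpoly_eval f (\<lambda>q. bad_coeff k s r b q w) = 0" for w
  proof (cases "\<exists>t\<in>?T. w (Inr t) \<noteq> 0")
    case True
    then obtain t where t: "t \<in> ?T" "w (Inr t) \<noteq> 0" by blast
    define w' where
      "w' = case_sum (\<lambda>u. w (Inr t) ^ r * w (Inl u)) (\<lambda>u. w (Inr u) / w (Inr t))"
    \<comment> \<open>Division by \<open>w (Inr t)\<close> has already made this coordinate
      1.\<close>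
    have "w'(Inr t := 1) = w'" using t(2) by (auto simp: w'_def fun_eq_iff)
    then have "mpoly_eval f (\<lambda>q. bad_coeff k s r b q w') = 0" using f(3)[OF t(1), of w'] by simp
    then show ?thesis unfolding w'_def bad_coeff_scale[OF t(2)] .
  next
    case False
    have "(0, 0) \<in> ?T" using pos by simp
    \<comment> \<open>With all arguments 0 every coefficient is 0. The zero map \<Gamma> gives the
      same values and may take an argument with a coordinate 1.\<close>
    moreover have "bad_coeff k s r b q w = bad_coeff k s r b q ((\<lambda>_. 0)(Inr (0, 0) := 1))" for q
    proof -
      have "bad_coeff k s r b q ((\<lambda>_. 0)(Inr (0, 0) := 1)) = 0" by (simp add: bad_coeff_def)
      then show ?thesis using False pos(1) by (subst bad_coeff_eq_0) auto
    qed
    ultimately show ?thesis using f(3)[of "(0, 0)" "\<lambda>_. 0"] by simp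
  qed
  then show ?thesis using f by blast
qed

text \<open>An infinite field contains grids with more points in each direction than the largest
  exponent of \<open>f\<close>; vanishing there would force all coefficients to be 0.\<close>

lemma nonzero_polynomial_nonvanishing:
  fixes f :: "('i, 'a::field) mpoly"
  assumes "finite I" "f \<in> mpolys I" "f \<noteq> 0" "infinite (UNIV :: 'a set)"
  shows "\<exists>u. mpoly_eval f u \<noteq> 0"
proof (rule ccontr)
  assume "\<not> ?thesis"
  then have zero: "mpoly_eval f u = 0" for u by simp
  \<comment> \<open>A crude common bound for all exponents.\<close>
  define d where "d = (\<Sum>e\<in>Poly_Mapping.keys f. mon_degree e)"
  have d: "Poly_Mapping.lookup e i \<le> d" if "e \<in> Poly_Mapping.keys f" "i \<in> I" for e i
  proof -
    have "Poly_Mapping.lookup e i \<le> (\<Sum>i\<in>I. Poly_Mapping.lookup e i)"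
      using assms(1) that by (intro member_le_sum) auto
    also have "\<dots> = mon_degree e"
      by (rule mon_degree_eq_sum[symmetric]) (use assms that in \<open>auto simp: mpolys_def\<close>)
    also have "\<dots> \<le> d" unfolding d_def using that by (intro member_le_sum) auto
    finally show ?thesis .
  qed
  obtain T :: "'a set" where T: "card T > d"
    using infinite_arbitrarily_large[OF assms(4), of "Suc d"] by (metis lessI)
  have "Poly_Mapping.lookup f e = 0" if "e \<in> Poly_Mapping.keys f" for e
  proof (rule polynomial_vanishing_on_grid_coeffs_0[OF assms(1) finite_keys T d _ _ that])
    show "e = e'" if "e \<in> Poly_Mapping.keys f" "e' \<in> Poly_Mapping.keys f"
      "\<And>i. i \<in> I \<Longrightarrow> Poly_Mapping.lookup e i = Poly_Mapping.lookup e' i" for e e'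
    proof (rule poly_mapping_eqI)
      fix i
      have "i \<notin> Poly_Mapping.keys e \<and> i \<notin> Poly_Mapping.keys e'" if "i \<notin> I"
        using \<open>e \<in> _\<close> \<open>e' \<in> _\<close> that assms(2) by (auto simp: mpolys_def)
      then show "Poly_Mapping.lookup e i = Poly_Mapping.lookup e' i"
        using that(3) by (cases "i \<in> I") (auto simp: in_keys_iff)
    qed
    show "(\<Sum>e\<in>Poly_Mapping.keys f. Poly_Mapping.lookup f e *
        (\<Prod>i\<in>I. u i ^ Poly_Mapping.lookup e i)) = 0" for u
      using zero[of u] assms(1,2) by (subst (asm) mpoly_eval_eq_sum[of "Poly_Mapping.keys f" I])
        (auto simp: mpolys_def)
  qed
  then have "f = 0" by (intro poly_mapping_eqI) (auto simp: in_keys_iff)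
  then show False using assms(3) by simp
qed

lemma mpoly_eval_cong:
  assumes "f \<in> mpolys I" "\<And>i. i \<in> I \<Longrightarrow> u i = u' i"
  shows "mpoly_eval f u = mpoly_eval f u'"
  unfolding mpoly_eval_def
  by (intro sum.cong prod.cong refl arg_cong2[where f = "(*)"])
    (use assms in \<open>auto simp: mpolys_def subset_iff\<close>)

text \<open>Each point is a family of constant functions in no variables, and 0 is less than
  \<open>card I\<close>; one relation then serves all the points.\<close>

lemma finite_point_set_relation:
  fixes A :: "('i \<Rightarrow> 'a::field) set"
  assumes "finite A" "finite I" "I \<noteq> {}"
  shows "\<exists>f\<in>mpolys I. f \<noteq> 0 \<and> (\<forall>u\<in>A. mpoly_eval f u = 0)"
proof -
  have "\<exists>f\<in>mpolys I. f \<noteq> 0 \<and> (\<forall>u\<in>A. \<forall>x :: unit \<Rightarrow> 'a. mpoly_eval f (\<lambda>i. u i) = 0)"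
  proof (rule common_algebraic_relation[OF assms(2,1,3), where V = "\<lambda>_. {}" and d = 0])
    show "(\<lambda>x :: unit \<Rightarrow> 'a. u i) \<in> box_polyfuns {} 0" for u :: "'i \<Rightarrow> 'a" and i
      by (auto simp: box_polyfuns_def)
  qed (use assms in \<open>auto simp: card_gt_0_iff\<close>)
  then show ?thesis by blast
qed

text \<open>
  Over a finite field the parametrisation cannot be onto, since all parameters with \<open>y = 0\<close> have
  the same image.
\<close>

lemma bad_coeff_not_surj_finite:
  fixes b :: "'e \<Rightarrow> nat \<Rightarrow> 'a::field"
  assumes fin: "finite (UNIV :: 'a set)" and I: "finite I" "\<And>q. q \<in> I \<Longrightarrow> fst q < m"
    and card: "card (bad_params k m s r) \<le> card I" and pos: "r \<ge> 1" "m \<ge> 1" "s \<ge> 1"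
  shows "\<exists>u. \<forall>w. \<exists>q\<in>I. u q \<noteq> bad_coeff k s r b q w"
proof -
  let ?V = "bad_params k m s r"
  let ?W = "?V \<rightarrow>\<^sub>E (UNIV :: 'a set)"
  define \<Psi> where "\<Psi> w = (\<lambda>q\<in>I. bad_coeff k s r b q w)" for w
  have "card (hom_monomials s r) > 0" using pos by (simp add: card_hom_monomials)
  then obtain h where h: "h \<in> hom_monomials s r" by (metis card.empty equals0I less_nat_zero_code)
  \<comment> \<open>Both parameter points have all arguments 0, hence the same image. They differ in
    one coefficient of the first component of \<Gamma>.\<close>
  define w0 where "w0 = (\<lambda>v\<in>?V. 0 :: 'a)"
  define w1 where "w1 = (\<lambda>v\<in>?V. if v = Inl (0, h) then 1 else 0 :: 'a)"
  have "Inl (0, h) \<in> ?V" using h pos by (auto simp: bad_params_def)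
  then have "w0 \<noteq> w1" by (auto simp: w0_def w1_def fun_eq_iff)
  moreover have "\<Psi> w0 = \<Psi> w1"
  proof -
    have "bad_coeff k s r b q w0 = 0" "bad_coeff k s r b q w1 = 0" for q
      by (rule bad_coeff_eq_0; use pos in \<open>auto simp: w0_def w1_def bad_params_def\<close>)+
    then show ?thesis by (simp add: \<Psi>_def)
  qed
  moreover have "w0 \<in> ?W" "w1 \<in> ?W" by (auto simp: w0_def w1_def)
  ultimately have "\<not> inj_on \<Psi> ?W" by (auto dest: inj_onD)
  moreover have finW: "finite ?W" using fin finite_bad_params by (simp add: finite_PiE)
  \<comment> \<open>The collision makes this strict, which settles the case of equally many
    parameters and coefficients.\<close>
  ultimately have "card (\<Psi> ` ?W) < card ?W"
    using card_image_le eq_card_imp_inj_on le_neq_implies_less by blast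
  also have "\<dots> = card (UNIV :: 'a set) ^ card ?V" by (simp add: card_PiE finite_bad_params)
  also have "\<dots> \<le> card (UNIV :: 'a set) ^ card I"
    using fin card by (intro power_increasing) (auto simp: Suc_le_eq card_gt_0_iff)
  also have "\<dots> = card (I \<rightarrow>\<^sub>E (UNIV :: 'a set))" using I(1) by (simp add: card_PiE)
  finally have "\<not> I \<rightarrow>\<^sub>E (UNIV :: 'a set) \<subseteq> \<Psi> ` ?W"
    using card_mono[of "\<Psi> ` ?W"] finW by (meson finite_imageI not_less)
  then obtain u where u: "u \<in> I \<rightarrow>\<^sub>E (UNIV :: 'a set)" "u \<notin> \<Psi> ` ?W" by blast
  have "\<exists>q\<in>I. u q \<noteq> bad_coeff k s r b q w" for w
  proof (rule ccontr)
    assume "\<not> ?thesis"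
    moreover have "bad_coeff k s r b q w = bad_coeff k s r b q (restrict w ?V)" if "q \<in> I" for q
      using I(2)[OF that] by (intro bad_coeff_cong) auto
    ultimately have "u = \<Psi> (restrict w ?V)"
      using u(1) by (auto simp: \<Psi>_def fun_eq_iff PiE_def extensional_def)
    then show False using u(2) by auto
  qed
  then show ?thesis by blast
qed

text \<open>Over a finite field some nonzero polynomial vanishes at all of the finitely many points,
  in particular on the image of the parametrisation.\<close>

lemma bad_coeff_relation:
  fixes b :: "'e \<Rightarrow> nat \<Rightarrow> 'a::field"
  assumes I: "finite I" "I \<noteq> {}" "\<And>q. q \<in> I \<Longrightarrow> fst q < m"
    and card: "card (bad_params k m s r) \<le> card I" and pos: "r \<ge> 1" "k \<ge> 1" "s \<ge> 1"
  shows "\<exists>f\<in>mpolys I. f \<noteq> 0 \<and> (\<forall>w. mpoly_eval f (\<lambda>q. bad_coeff k s r b q w) = 0)"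
proof (cases "finite (UNIV :: 'a set)")
  case True
  then have "finite (I \<rightarrow>\<^sub>E (UNIV :: 'a set))" using I(1) by (simp add: finite_PiE)
  from finite_point_set_relation[OF this I(1,2)]
  obtain f where f: "f \<in> mpolys I" "f \<noteq> 0" "\<forall>u\<in>I \<rightarrow>\<^sub>E (UNIV :: 'a set). mpoly_eval f u = 0"
    by blast
  have "mpoly_eval f u = 0" for u
    using f(3) mpoly_eval_cong[OF f(1), of u "restrict u I"] by auto
  then show ?thesis using f by blast
qed (rule bad_coeff_relation_infinite[OF assms])

text \<open>This will make the exceptional set proper, which positive codimension does not ensure
  over a finite field. Over an infinite field, a point where the relation does not vanish is not
  attained.\<close>

lemma bad_coeff_not_surj:
  fixes b :: "'e \<Rightarrow> nat \<Rightarrow> 'a::field"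
  assumes I: "finite I" "I \<noteq> {}" "\<And>q. q \<in> I \<Longrightarrow> fst q < m"
    and card: "card (bad_params k m s r) \<le> card I" and pos: "r \<ge> 1" "k \<ge> 1" "m \<ge> 1" "s \<ge> 1"
  shows "\<exists>u. \<forall>w. \<exists>q\<in>I. u q \<noteq> bad_coeff k s r b q w"
proof (cases "finite (UNIV :: 'a set)")
  case True
  show ?thesis by (rule bad_coeff_not_surj_finite[OF True I(1,3) card pos(1,3,4)])
next
  case False
  obtain f where f: "f \<in> mpolys I" "f \<noteq> 0" "\<forall>w. mpoly_eval f (\<lambda>q. bad_coeff k s r b q w) = 0"
    using bad_coeff_relation[OF I card pos(1,2,4)] by blast
  obtain u where u: "mpoly_eval f u \<noteq> 0"
    using nonzero_polynomial_nonvanishing[OF I(1) f(1,2) False] by blast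
  have "\<exists>q\<in>I. u q \<noteq> bad_coeff k s r b q w" for w
    using f(3) u mpoly_eval_cong[OF f(1), of u "\<lambda>q. bad_coeff k s r b q w"] by metis
  then show ?thesis by blast
qed

section \<open>The exceptional set and the elusive tuple\<close>

lemma Pol_hom_coeffs_exist:
  fixes u :: "nat \<times> (nat \<Rightarrow>\<^sub>0 nat) \<Rightarrow> 'a::zero"
  shows "\<exists>P\<in>Pol_hom n m d. \<forall>q\<in>{..<m} \<times> hom_monomials n d. coeff_coord P q = u q"
proof -
  have "\<exists>f. (\<forall>e. Poly_Mapping.lookup f e = (if e \<in> hom_monomials n d then u (j, e) else 0)) \<and>
      Poly_Mapping.keys f \<subseteq> hom_monomials n d" for j
    using obtain_poly_mapping[OF finite_hom_monomials, of n d "\<lambda>e. u (j, e)"] by metis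
  then obtain F where F: "\<And>j e. Poly_Mapping.lookup (F j) e =
      (if e \<in> hom_monomials n d then u (j, e) else 0)"
    "\<And>j. Poly_Mapping.keys (F j) \<subseteq> hom_monomials n d" by metis
  show ?thesis
    by (rule bexI[of _ "restrict F {..<m}"]) (auto simp: Pol_hom_def hom_polys_def F coeff_coord_def)
qed

theorem theorem3p10:
  fixes n m p s r k :: nat
  assumes "n \<ge> 1" and "m \<ge> 1" and "p \<ge> 1" and "s \<ge> 1" and "r \<ge> 1"
    and "s \<le> m - 1"
    and "real ((n + p - 1) choose p) \<ge>
           real m * real ((s + r - 1) choose r) / (real m - real s)"
    and "CHAR('a::field) = 0 \<or> p \<le> CHAR('a) - 1"
    and "k = (n + p - 1) choose p"
  shows "\<exists>Z. Z \<subset> (Pol_hom n m p :: (nat \<Rightarrow> (nat, 'a) mpoly) set) \<and>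
           Pol_codim n m p Z \<ge> 1 \<and>
           (\<forall>P \<in> Pol_hom n m p - Z.
              \<exists>a \<in> {..<k} \<rightarrow>\<^sub>E poly_image n m P. weakly_elusive m s r (a ` {..<k}))"
proof -
  let ?I = "{..<m} \<times> hom_monomials n p"
  have k: "card (hom_monomials n p) = k" using assms(9) by (simp add: card_hom_monomials)
  have k1: "k \<ge> 1" using assms(1,3,9) by (simp add: Suc_le_eq)
  have I: "finite ?I" "?I \<noteq> {}" "\<And>q. q \<in> ?I \<Longrightarrow> fst q < m" "card ?I = m * k"
    using finite_hom_monomials k k1 assms(2) by (auto simp: card_cartesian_product lessThan_empty_iff)
  have "s < m" using assms(2,6) by linarith
  then have "real m * real ((s + r - 1) choose r) \<le> real k * (real m - real s)"
    using assms(7,9) by (simp add: divide_le_eq)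
  then have "real (m * ((s + r - 1) choose r) + k * s) \<le> real (m * k)"
    by (simp add: algebra_simps)
  then have card: "card (bad_params k m s r) \<le> card ?I"
    unfolding card_bad_params I(4) of_nat_le_iff .
  \<comment> \<open>The points depend only on \<open>n\<close> and \<open>p\<close>, so the same
    ones serve every \<open>P\<close>.\<close>
  obtain x and b :: "(nat \<Rightarrow>\<^sub>0 nat) \<Rightarrow> nat \<Rightarrow> 'a" where x: "\<And>i. x i \<in> affine_space n"
    and b: "\<And>e f. e \<in> hom_monomials n p \<Longrightarrow> f \<in> hom_polys n p \<Longrightarrow>
      Poly_Mapping.lookup f e = (\<Sum>i<k. b e i * mpoly_eval f (x i))"
    using exists_interpolation_points[OF exists_set_card_gt[OF assms(8)], of n] unfolding k by blast
  \<comment> \<open>The image of the parametrisation; it contains every \<open>P\<close> whose tuple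
    of values at the \<open>x i\<close> is not weakly elusive.\<close>
  define Z where "Z = {P \<in> Pol_hom n m p. \<exists>w. \<forall>q\<in>?I. coeff_coord P q = bad_coeff k s r b q w}"
  have "\<exists>P\<in>Pol_hom n m p. P \<notin> Z"
  proof -
    obtain u where u: "\<forall>w. \<exists>q\<in>?I. u q \<noteq> bad_coeff k s r b q w"
      using bad_coeff_not_surj[OF I(1-3) card assms(5) k1 assms(2,4), of b] by blast
    obtain P where P: "P \<in> Pol_hom n m p" "\<forall>q\<in>?I. coeff_coord P q = u q"
      using Pol_hom_coeffs_exist[of n m p u] by blast
    have "P \<notin> Z"
    proof
      assume "P \<in> Z"
      then obtain w where "\<forall>q\<in>?I. coeff_coord P q = bad_coeff k s r b q w"
        unfolding Z_def by blast
      then show False using u P(2) by metis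
    qed
    then show ?thesis using P(1) by blast
  qed
  then have "Z \<subset> Pol_hom n m p" unfolding Z_def by blast
  moreover have "Pol_codim n m p Z \<ge> 1"
  proof -
    obtain f where f: "f \<in> mpolys ?I" "f \<noteq> 0"
      "\<forall>w. mpoly_eval f (\<lambda>q. bad_coeff k s r b q w) = 0"
      using bad_coeff_relation[OF I(1-3) card assms(5) k1 assms(4), of b] by blast
    have "mpoly_eval f (coeff_coord P) = 0" if PZ: "P \<in> Z" for P
    proof -
      obtain w where "\<forall>q\<in>?I. coeff_coord P q = bad_coeff k s r b q w"
        using PZ unfolding Z_def by blast
      then have "mpoly_eval f (coeff_coord P) = mpoly_eval f (\<lambda>q. bad_coeff k s r b q w)"
        by (intro mpoly_eval_cong[OF f(1)]) blast
      then show ?thesis using f(3) by simp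
    qed
    then have "f \<in> vanishing_ideal ?I (coeff_coord ` Z)"
      using f(1) by (auto simp: vanishing_ideal_def)
    then show ?thesis unfolding Pol_codim_def using f(2) by (rule one_le_codimension)
  qed
  moreover have "\<exists>a \<in> {..<k} \<rightarrow>\<^sub>E poly_image n m P. weakly_elusive m s r (a ` {..<k})"
    if P: "P \<in> Pol_hom n m p - Z" for P
  proof
    let ?a = "\<lambda>i\<in>{..<k}. poly_map m P (x i)"
    show "?a \<in> {..<k} \<rightarrow>\<^sub>E poly_image n m P" using x by (auto simp: poly_image_def)
    have "False" if \<Gamma>: "\<Gamma> \<in> Pol_hom s m r" and sub: "?a ` {..<k} \<subseteq> poly_image s m \<Gamma>" for \<Gamma>
    proof -
      have "\<forall>i\<in>{..<k}. \<exists>y. poly_map m P (x i) = poly_map m \<Gamma> y"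
        using sub by (auto simp: poly_image_def)
      then obtain y where y: "\<And>i. i < k \<Longrightarrow> poly_map m P (x i) = poly_map m \<Gamma> (y i)"
        by (metis lessThan_iff)
      have eval: "mpoly_eval (P j) (x i) = mpoly_eval (\<Gamma> j) (y i)" if "i < k" "j < m" for i j
        using fun_cong[OF y[OF that(1)], of j] that(2) by (simp add: poly_map_def)
      \<comment> \<open>Coefficients of \<Gamma> together with the coordinates of preimages of the
        values \<open>P(x i)\<close>; this parameter point puts \<open>P\<close> into
        \<open>Z\<close>.\<close>
      define w where "w = case_sum (coeff_coord \<Gamma>) (\<lambda>(i, l). y i l)"
      have "coeff_coord P (j, e) = bad_coeff k s r b (j, e) w"
        if j: "j < m" and e: "e \<in> hom_monomials n p" for j e
      proof -
        have Pj: "P j \<in> hom_polys n p" and \<Gamma>j: "\<Gamma> j \<in> hom_polys s r"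
          using P \<Gamma> j by (auto simp: Pol_hom_def)
        have "coeff_coord P (j, e) = (\<Sum>i<k. b e i * mpoly_eval (\<Gamma> j) (y i))"
          using b[OF e Pj] eval j by (simp add: coeff_coord_def)
        then show ?thesis
          by (simp add: bad_coeff_def mpoly_eval_hom_poly[OF \<Gamma>j] w_def coeff_coord_def)
      qed
      then have "P \<in> Z" using P by (auto simp: Z_def)
      then show False using P by blast
    qed
    moreover have "?a ` {..<k} \<subseteq> affine_space m"
      by (auto simp: poly_map_def affine_space_def split: if_splits)
    ultimately show "weakly_elusive m s r (?a ` {..<k})"
      unfolding weakly_elusive_def by blast
  qed
  ultimately show ?thesis by blast
qed

end
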